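(* Let $n\ge1$ and let $(X,\lVert\cdot\rVert_X)$ be a rearrangement-invariant quasi-Banach function space over $(\mathbb R^n,\lambda^n)$. Denote its modulus of concavity by $C$ and put $b=\left(\frac23\right)^{1/n}$. Then the dilation operator $D_a$ is bounded on $X$ for any $a\in(0,\infty)$ and its operator norm satisfies $$\lVert D_a\rVert\le\begin{cases}2C\,a^{\frac{\log(2C)}{\log(b)}} & \text{for } a\in(0,1),\\ 1 & \text{for } a\in[1,\infty).\end{cases}$$
   Context: $\lambda^n$ is the Lebesgue measure on $\mathbb R^n$. $M=M(\mathbb R^n,\lambda^n)$ is the set of all measurable functions $\mathbb R^n\to\mathbb C\cup\{\infty\}$, functions equal a.e. being identified; $M_+$ is the subset of functions with values in $[0,\infty]$. A quasi-Banach function norm is a map $\lVert\cdot\rVert:M\to[0,\infty]$ with $\lVert\,|f|\,\rVert=\lVert f\rVert$ for all $f\in M$ whose restriction to $M_+$ satisfies: (Q1) (a) $\lVert af\rVert=|a|\lVert f\rVert$ for all $a\in\mathbb C$, $f\in M_+$ (with the usual convention $0\cdot\infty=0$); (b) $\lVert f\rVert=0$ iff $f=0$ a.e.; (c) there is a constant $C\ge1$, called the modulus of concavity, such that $\lVert f+g\rVert\le C(\lVert f\rVert+\lVert g\rVert)$ for all $f,g\in M_+$; (P2) if $f,g\in M_+$ and $f\le g$ a.e., then $\lVert f\rVert\le\lVert g\rVert$; (P3) if $f_k,f\in M_+$ and $f_k\uparrow f$ a.e., then $\lVert f_k\rVert\uparrow\lVert f\rVert$; (P4) $\lVert\chi_E\rVert<\infty$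 for every measurable $E\subseteq\mathbb R^n$ with $\lambda^n(E)<\infty$. The corresponding quasi-Banach function space is $X=\{f\in M:\lVert f\rVert_X<\infty\}$ with the quasinorm $\lVert\cdot\rVert_X$. For $f\in M$, the distribution function is $\mu_f(s)=\lambda^n(\{x:|f(x)|>s\})$, $s\in[0,\infty)$, and the non-increasing rearrangement is $f^*(t)=\inf\{s\in[0,\infty):\mu_f(s)\le t\}$, $t\in[0,\infty)$ (with $\inf\emptyset=\infty$). $X$ is rearrangement invariant if $\lVert f\rVert_X=\lVert g\rVert_X$ whenever $f,g\in M$ satisfy $f^*=g^*$. The dilation operator is $D_af(x)=f(ax)$ for $f\in M$, $x\in\mathbb R^n$; its operator norm is $\lVert D_a\rVert=\sup\{\lVert D_af\rVert_X:\lVert f\rVert_X\le1\}$, and $D_a$ is bounded on $X$ if $\lVert D_a\rVert<\infty$. *)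

theory Defs
  imports "HOL-Analysis.Analysis"
begin

(* Values in the one-point compactification of the complex plane; None is the point infinity. *)
type_synonym ecomplex = "complex option"

definition ecomplex_borel :: "ecomplex measure" where
  "ecomplex_borel = sigma UNIV (Collect (openin (Alexandroff_compactification euclidean)))"

fun emod :: "ecomplex \<Rightarrow> ennreal" where
  "emod None = \<infinity>"
| "emod (Some z) = ennreal (cmod z)"

(* The inclusion of [0,\<infinity>] into the extended complex plane. *)
definition ecomplex_of_ennreal :: "ennreal \<Rightarrow> ecomplex" where
  "ecomplex_of_ennreal t = (if t = \<infinity> then None else Some (complex_of_real (enn2real t)))"

fun escale :: "complex \<Rightarrow> ecomplex \<Rightarrow> ecomplex" where
  "escale a None = (if a = 0 then Some 0 else None)"
| "escale a (Some z) = Some (a * z)"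

(* Functions equal almost everywhere are not identified on the level of types; instead,
   every quasi-Banach function norm below is required to respect almost everywhere equality. *)
definition Meas :: "(real ^ 'n \<Rightarrow> ecomplex) set" where
  "Meas = lebesgue \<rightarrow>\<^sub>M ecomplex_borel"

(* A function u with values in [0,\<infinity>] is regarded as the element of_nonneg u of Meas.
   Lemma of_nonneg_image shows that of_nonneg maps the measurable such functions onto the
   elements of Meas with values in [0,\<infinity>]. *)
definition of_nonneg :: "(real ^ 'n \<Rightarrow> ennreal) \<Rightarrow> (real ^ 'n \<Rightarrow> ecomplex)" where
  "of_nonneg u = (\<lambda>x. ecomplex_of_ennreal (u x))"

definition modulus_of_concavity :: "((real ^ 'n \<Rightarrow> ecomplex) \<Rightarrow> ennreal) \<Rightarrow> real \<Rightarrow> bool" where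
  "modulus_of_concavity N C \<longleftrightarrow> 1 \<le> C \<and>
     (\<forall>u\<in>borel_measurable lebesgue. \<forall>v\<in>borel_measurable lebesgue.
        N (of_nonneg (\<lambda>x. u x + v x)) \<le> ennreal C * (N (of_nonneg u) + N (of_nonneg v)))"

(* N is only constrained on Meas; its values at non-measurable functions are irrelevant. *)
definition quasi_Banach_function_norm :: "((real ^ 'n \<Rightarrow> ecomplex) \<Rightarrow> ennreal) \<Rightarrow> bool" where
  "quasi_Banach_function_norm N \<longleftrightarrow>
     (\<forall>f\<in>Meas. \<forall>g\<in>Meas. (AE x in lebesgue. f x = g x) \<longrightarrow> N f = N g) \<and>
     (\<forall>f\<in>Meas. N (of_nonneg (\<lambda>x. emod (f x))) = N f) \<and>
     (\<forall>a. \<forall>u\<in>borel_measurable lebesgue.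
        N (\<lambda>x. escale a (of_nonneg u x)) = ennreal (cmod a) * N (of_nonneg u)) \<and>
     (\<forall>u\<in>borel_measurable lebesgue. N (of_nonneg u) = 0 \<longleftrightarrow> (AE x in lebesgue. u x = 0)) \<and>
     (\<exists>C. modulus_of_concavity N C) \<and>
     (\<forall>u\<in>borel_measurable lebesgue. \<forall>v\<in>borel_measurable lebesgue.
        (AE x in lebesgue. u x \<le> v x) \<longrightarrow> N (of_nonneg u) \<le> N (of_nonneg v)) \<and>
     (\<forall>u v. (\<forall>k. u k \<in> borel_measurable lebesgue) \<longrightarrow> v \<in> borel_measurable lebesgue \<longrightarrow>
        (AE x in lebesgue. incseq (\<lambda>k. u k x) \<and> (\<lambda>k. u k x) \<longlonglongrightarrow> v x) \<longrightarrow>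
        incseq (\<lambda>k. N (of_nonneg (u k))) \<and> (\<lambda>k. N (of_nonneg (u k))) \<longlonglongrightarrow> N (of_nonneg v)) \<and>
     (\<forall>E\<in>sets lebesgue. emeasure lebesgue E < \<infinity> \<longrightarrow> N (of_nonneg (indicator E)) < \<infinity>)"

definition function_space ::
  "((real ^ 'n \<Rightarrow> ecomplex) \<Rightarrow> ennreal) \<Rightarrow> (real ^ 'n \<Rightarrow> ecomplex) set" where
  "function_space N = {f \<in> Meas. N f < \<infinity>}"

definition distribution_function :: "(real ^ 'n \<Rightarrow> ecomplex) \<Rightarrow> real \<Rightarrow> ennreal" where
  "distribution_function f s = emeasure lebesgue {x. emod (f x) > ennreal s}"

(* The infimum of the empty set in ennreal is \<infinity>. *)
definition rearrangement :: "(real ^ 'n \<Rightarrow> ecomplex) \<Rightarrow> real \<Rightarrow> ennreal" where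
  "rearrangement f t = (INF s\<in>{s. 0 \<le> s \<and> distribution_function f s \<le> ennreal t}. ennreal s)"

definition rearrangement_invariant :: "((real ^ 'n \<Rightarrow> ecomplex) \<Rightarrow> ennreal) \<Rightarrow> bool" where
  "rearrangement_invariant N \<longleftrightarrow>
     (\<forall>f\<in>Meas. \<forall>g\<in>Meas. (\<forall>t\<ge>0. rearrangement f t = rearrangement g t) \<longrightarrow> N f = N g)"

definition dilation :: "real \<Rightarrow> (real ^ 'n \<Rightarrow> ecomplex) \<Rightarrow> (real ^ 'n \<Rightarrow> ecomplex)" where
  "dilation a f = (\<lambda>x. f (a *\<^sub>R x))"

definition dilation_norm :: "((real ^ 'n \<Rightarrow> ecomplex) \<Rightarrow> ennreal) \<Rightarrow> real \<Rightarrow> ennreal" where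
  "dilation_norm N a = (SUP f\<in>{f \<in> function_space N. N f \<le> 1}. N (dilation a f))"

definition dilation_bounded :: "((real ^ 'n \<Rightarrow> ecomplex) \<Rightarrow> ennreal) \<Rightarrow> real \<Rightarrow> bool" where
  "dilation_bounded N a \<longleftrightarrow> dilation_norm N a < \<infinity>"

lemma space_ecomplex_borel [simp]: "space ecomplex_borel = UNIV"
  by (simp add: ecomplex_borel_def space_measure_of_conv)

lemma sets_ecomplex_borel_open:
  "openin (Alexandroff_compactification euclidean) U \<Longrightarrow> U \<in> sets ecomplex_borel"
  by (auto simp: ecomplex_borel_def)

lemma emod_ecomplex_of_ennreal [simp]: "emod (ecomplex_of_ennreal t) = t"
  by (auto simp: ecomplex_of_ennreal_def less_top)

lemma measurable_emod [measurable]: "emod \<in> borel_measurable ecomplex_borel"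
proof (rule borel_measurableI_greater)
  fix y :: ennreal
  have "{x. y < emod x} \<in> sets ecomplex_borel"
  proof (cases y)
    case (real r)
    have "x \<in> {x. y < emod x} \<longleftrightarrow> x \<in> insert None (Some ` (UNIV - cball 0 r))" for x
      using real by (cases x) (auto simp: ennreal_less_iff)
    then have eq: "{x. y < emod x} = insert None (Some ` (UNIV - cball 0 r))"
      by blast
    have "openin (Alexandroff_compactification euclidean)
        (insert None (Some ` (UNIV - cball (0::complex) r)))"
      unfolding openin_Alexandroff_compactification
      by (intro disjI2 exI[of _ "cball (0::complex) r"]) simp
    then show ?thesis
      unfolding eq by (rule sets_ecomplex_borel_open)
  qed simp
  then show "{x \<in> space ecomplex_borel. y < emod x} \<in> sets ecomplex_borel" by simp
qed

lemma measurable_ecomplex_of_ennreal [measurable]: "ecomplex_of_ennreal \<in> borel \<rightarrow>\<^sub>M ecomplex_borel"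
proof -
  have m: "ecomplex_of_ennreal -` (Some ` U) \<in> sets borel" if "U \<in> sets borel" for U
  proof -
    have "ecomplex_of_ennreal -` (Some ` U) =
        {t \<in> space borel. t \<noteq> \<infinity> \<and> complex_of_real (enn2real t) \<in> U}"
      by (auto simp: ecomplex_of_ennreal_def split: if_splits)
    also have "\<dots> \<in> sets borel" using that by measurable
    finally show ?thesis .
  qed
  have i: "ecomplex_of_ennreal -` {None} = {\<infinity>}"
    by (auto simp: ecomplex_of_ennreal_def split: if_splits)
  show ?thesis
    unfolding ecomplex_borel_def
  proof (rule measurable_sigma_sets)
    fix V assume "V \<in> Collect (openin (Alexandroff_compactification (euclidean :: complex topology)))"
    then consider U where "V = Some ` U" "open U"
      | K where "V = {None} \<union> Some ` (UNIV - K)" "closed K"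
      by (auto simp: openin_Alexandroff_compactification)
    then have "ecomplex_of_ennreal -` V \<in> sets borel"
    proof cases
      case 1
      then show ?thesis using m by simp
    next
      case (2 K)
      have "ecomplex_of_ennreal -` V =
          ecomplex_of_ennreal -` {None} \<union> ecomplex_of_ennreal -` (Some ` (UNIV - K))"
        unfolding 2(1) by blast
      moreover have "ecomplex_of_ennreal -` (Some ` (UNIV - K)) \<in> sets borel"
        using 2(2) by (intro m) auto
      ultimately show ?thesis using i by simp
    qed
    then show "ecomplex_of_ennreal -` V \<inter> space borel \<in> sets borel" by simp
  qed auto
qed

lemma of_nonneg_image:
  "of_nonneg ` borel_measurable (lebesgue :: (real ^ 'n) measure) =
     {f \<in> Meas. range f \<subseteq> range ecomplex_of_ennreal}" (is "?L = ?R")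
proof
  show "?L \<subseteq> ?R"
    unfolding of_nonneg_def Meas_def by (auto intro!: measurable_compose[OF _ measurable_ecomplex_of_ennreal])
  show "?R \<subseteq> ?L"
  proof
    fix f :: "real ^ 'n \<Rightarrow> ecomplex" assume f: "f \<in> ?R"
    have "(\<lambda>x. emod (f x)) \<in> borel_measurable lebesgue"
      using f by (auto simp: Meas_def intro: measurable_compose[OF _ measurable_emod])
    moreover have "f = of_nonneg (\<lambda>x. emod (f x))"
    proof
      fix x
      obtain t where "f x = ecomplex_of_ennreal t" using f by blast
      then show "f x = of_nonneg (\<lambda>x. emod (f x)) x" by (simp add: of_nonneg_def)
    qed
    ultimately show "f \<in> ?L" by blast
  qed
qed

end

theory Submission
  imports Defs
begin

text \<open>
  Every f has the same distribution function as the radially decreasing function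
  R f(x) = f*(\<omega> |x|^n), where \<omega> is the volume of the unit ball. Since f* is monotone in the
  distribution function, so is every rearrangement-invariant norm. As D_a f has distribution
  function a^(-n) \<mu>_f, this gives the bound 1 for a \<ge> 1 and the monotonicity of the norm of D_a
  in a. A hyperplane through the origin cuts R (D_b f) into two halves, each with distribution
  function (1/2) (3/2) \<mu>_f \<le> \<mu>_f, so D_b has norm at most 2C. For a < 1, compare D_a with the
  least power D_b^k such that b^k \<le> a.
\<close>

text \<open>The argument of \<open>rearrangement\<close> is the volume of the ball of radius
  \<open>norm x\<close>. Hence superlevel sets become centred balls, or the whole space, of the
  prescribed measure.\<close>

definition radial_rearrangement :: "(real ^ 'n \<Rightarrow> ecomplex) \<Rightarrow> real ^ 'n \<Rightarrow> ennreal" where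
  "radial_rearrangement f x = rearrangement f (unit_ball_vol (real CARD('n)) * norm x ^ CARD('n))"

section \<open>Measurability, and distribution functions under dilation\<close>

lemma sets_superlevel_emod:
  fixes f :: "real ^ 'n \<Rightarrow> ecomplex"
  assumes "f \<in> Meas"
  shows "{x. y < emod (f x)} \<in> sets lebesgue"
proof -
  have "(\<lambda>x. emod (f x)) \<in> borel_measurable lebesgue"
    using assms by (auto simp: Meas_def intro: measurable_compose[OF _ measurable_emod])
  then have "{x \<in> space lebesgue. y < emod (f x)} \<in> sets lebesgue" by measurable
  then show ?thesis by simp
qed

lemma of_nonneg_in_Meas:
  fixes u :: "real ^ 'n \<Rightarrow> ennreal"
  assumes "u \<in> borel_measurable lebesgue"
  shows "of_nonneg u \<in> Meas"
  using of_nonneg_image assms by blast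

lemma distribution_function_of_nonneg:
  "distribution_function (of_nonneg u) s = emeasure lebesgue {x. ennreal s < u x}"
  by (simp add: distribution_function_def of_nonneg_def)

lemma dilation_in_Meas:
  fixes f :: "real ^ 'n \<Rightarrow> ecomplex"
  assumes "f \<in> Meas"
  shows "dilation a f \<in> Meas"
  using measurable_compose[OF lebesgue_measurable_scaling, of f ecomplex_borel a] assms
  by (simp add: Meas_def dilation_def)

lemma emeasure_lebesgue_scaleR:
  fixes S :: "(real ^ 'n) set"
  shows "emeasure lebesgue ((*\<^sub>R) m ` S) = ennreal (\<bar>m\<bar> ^ CARD('n)) * emeasure lebesgue S"
  using emeasure_lebesgue_affine[of m 0 S] by (simp add: ennreal_power)

lemma distribution_function_dilation:
  fixes f :: "real ^ 'n \<Rightarrow> ecomplex"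
  assumes "0 < a"
  shows "distribution_function (dilation a f) s = ennreal (1 / a ^ CARD('n)) * distribution_function f s"
proof -
  \<comment> \<open>Superlevel sets of the dilated function are those of \<open>f\<close> shrunk by
    \<open>1/a\<close>, which is where the factor a^(-n) arises.\<close>
  have "{x. ennreal s < emod (dilation a f x)} = (*\<^sub>R) (1/a) ` {x. ennreal s < emod (f x)}"
  proof (intro set_eqI iffI)
    fix x assume "x \<in> {x. ennreal s < emod (dilation a f x)}"
    then show "x \<in> (*\<^sub>R) (1/a) ` {x. ennreal s < emod (f x)}"
      using assms by (intro image_eqI[of _ _ "a *\<^sub>R x"]) (auto simp: dilation_def)
  qed (use assms in \<open>auto simp: dilation_def\<close>)
  then show ?thesis
    using assms unfolding distribution_function_def
    by (simp only: emeasure_lebesgue_scaleR) (simp add: power_divide)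
qed

section \<open>The rearrangement as generalized inverse of the distribution function\<close>

text \<open>Continuity of measure from below along the thresholds
  \<open>s + 1 / real (Suc k)\<close>. The form with strict inequalities also covers an infinite
  value at \<open>s\<close>.\<close>

lemma distribution_function_right_continuous:
  fixes f :: "real ^ 'n \<Rightarrow> ecomplex"
  assumes f: "f \<in> Meas" and s: "0 \<le> s" and t: "t < distribution_function f s"
  obtains r where "s < r" "t < distribution_function f r"
proof -
  define A where "A k = {x. ennreal (s + 1 / real (Suc k)) < emod (f x)}" for k
  have inc: "incseq A"
  proof (rule incseq_SucI)
    fix k
    have "ennreal (s + 1 / real (Suc (Suc k))) \<le> ennreal (s + 1 / real (Suc k))"
      by (intro ennreal_leI add_left_mono divide_left_mono) auto
    then show "A k \<subseteq> A (Suc k)" by (auto simp: A_def intro: le_less_trans)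
  qed
  have "(\<Union>k. A k) = {x. ennreal s < emod (f x)}"
  proof (intro set_eqI iffI)
    fix x assume "x \<in> (\<Union>k. A k)"
    then obtain k where "ennreal (s + 1 / real (Suc k)) < emod (f x)" by (auto simp: A_def)
    moreover have "ennreal s \<le> ennreal (s + 1 / real (Suc k))" by (intro ennreal_leI) simp
    ultimately show "x \<in> {x. ennreal s < emod (f x)}" by auto
  next
    fix x assume x: "x \<in> {x. ennreal s < emod (f x)}"
    show "x \<in> (\<Union>k. A k)"
    proof (cases "emod (f x)")
      case (real r)
      then have "0 < r - s" using x s by (simp add: ennreal_less_iff)
      then obtain k where "1 / real (Suc k) < r - s"
        using reals_Archimedean[of "r - s"] by (auto simp: inverse_eq_divide)
      then have "ennreal (s + 1 / real (Suc k)) < ennreal r"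
        using s by (subst ennreal_less_iff) (auto intro!: add_nonneg_nonneg simp del: of_nat_Suc)
      then show ?thesis using real by (auto simp: A_def)
    qed (auto simp: A_def)
  qed
  moreover have "range A \<subseteq> sets lebesgue"
    using sets_superlevel_emod[OF f] by (auto simp: A_def)
  ultimately have "(SUP k. emeasure lebesgue (A k)) = distribution_function f s"
    using SUP_emeasure_incseq[OF _ inc, of lebesgue] unfolding distribution_function_def by simp
  then obtain k where "t < emeasure lebesgue (A k)"
    using t by (metis less_SUP_iff)
  then show thesis
    using that[of "s + 1 / real (Suc k)"] by (simp add: A_def distribution_function_def)
qed

text \<open>Right continuity supplies a threshold \<open>r > s\<close> that is still not admissible
  in the infimum, so the infimum stays strictly above \<open>s\<close>. The equivalence turns
  superlevel sets of the rearrangement into conditions on its argument.\<close>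

lemma less_rearrangement_iff:
  fixes f :: "real ^ 'n \<Rightarrow> ecomplex"
  assumes f: "f \<in> Meas" and s: "0 \<le> s"
  shows "ennreal s < rearrangement f t \<longleftrightarrow> ennreal t < distribution_function f s"
proof
  assume *: "ennreal s < rearrangement f t"
  show "ennreal t < distribution_function f s"
  proof (rule ccontr)
    assume "\<not> ennreal t < distribution_function f s"
    then have "rearrangement f t \<le> ennreal s"
      unfolding rearrangement_def using s by (intro INF_lower) auto
    with * show False by simp
  qed
next
  assume "ennreal t < distribution_function f s"
  then obtain r where r: "s < r" "ennreal t < distribution_function f r"
    using distribution_function_right_continuous[OF f s] by blast
  have "ennreal r \<le> rearrangement f t"
    unfolding rearrangement_def
  proof (rule INF_greatest)
    fix q assume q: "q \<in> {q. 0 \<le> q \<and> distribution_function f q \<le> ennreal t}"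
    \<comment> \<open>An admissible \<open>q\<close> below \<open>r\<close> would force the
      distribution function at \<open>r\<close> down to \<open>ennreal t\<close>, contrary to the
      choice of \<open>r\<close>.\<close>
    have "distribution_function f r \<le> distribution_function f q" if "q < r"
      unfolding distribution_function_def
      using that sets_superlevel_emod[OF f]
      by (intro emeasure_mono) (auto intro: le_less_trans[OF ennreal_leI[OF less_imp_le]])
    then show "ennreal r \<le> ennreal q"
      using q r(2) by (intro ennreal_leI) (auto simp: not_less[symmetric])
  qed
  moreover have "ennreal s < ennreal r" using r(1) s by (simp add: ennreal_less_iff)
  ultimately show "ennreal s < rearrangement f t" by (rule less_le_trans[rotated])
qed

lemma rearrangement_mono:
  assumes "\<And>s. 0 \<le> s \<Longrightarrow> distribution_function f s \<le> distribution_function g s"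
  shows "rearrangement f t \<le> rearrangement g t"
  unfolding rearrangement_def
  using assms by (intro INF_superset_mono) (auto intro: order_trans)

section \<open>The radial rearrangement is equimeasurable with the function\<close>

text \<open>For finite \<open>m\<close> the set is the open centred ball of volume \<open>m\<close>;
  for infinite \<open>m\<close> it is the whole space.\<close>

lemma sublevel_volume:
  fixes m :: ennreal
  defines "S \<equiv> {x :: real ^ 'n. ennreal (unit_ball_vol (real CARD('n)) * norm x ^ CARD('n)) < m}"
  shows "S \<in> sets lebesgue" "emeasure lebesgue S = m"
proof -
  have "S \<in> sets lebesgue \<and> emeasure lebesgue S = m"
  proof (cases m)
    case (real r)
    define w where "w = unit_ball_vol (real CARD('n))"
    have w: "0 < w" by (simp add: w_def)
    \<comment> \<open>The radius for which the ball has volume \<open>r\<close>.\<close>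
    define q where "q = root CARD('n) (r / w)"
    have q: "0 \<le> q" "q ^ CARD('n) = r / w"
      using real w by (auto simp: q_def)
    have "ennreal (w * norm x ^ CARD('n)) < m \<longleftrightarrow> norm x < q" for x :: "real ^ 'n"
    proof -
      have "ennreal (w * norm x ^ CARD('n)) < m \<longleftrightarrow> norm x ^ CARD('n) < q ^ CARD('n)"
        using real w unfolding q(2) by (simp add: ennreal_less_iff field_simps)
      also have "\<dots> \<longleftrightarrow> norm x < q"
        using q(1) power_strict_mono[of "norm x" q "CARD('n)"] power_less_imp_less_base[of "norm x" "CARD('n)" q]
        by (meson norm_ge_zero zero_less_card_finite)
      finally show ?thesis .
    qed
    then have "S = {x. norm x < q}" by (simp only: S_def w_def)
    then have "S = ball 0 q" by (simp add: ball_def)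
    moreover have "emeasure lborel (ball (0 :: real ^ 'n) q) = m"
    proof -
      have "emeasure lborel (ball (0 :: real ^ 'n) q) = ennreal (w * q ^ CARD('n))"
        using emeasure_ball[OF q(1), of "0 :: real ^ 'n"] by (simp add: w_def)
      also have "w * q ^ CARD('n) = r" using q(2) w by simp
      finally show ?thesis using real by simp
    qed
    ultimately show ?thesis by simp
  next
    case top
    then have "S = UNIV" by (simp add: S_def)
    then show ?thesis using top by simp
  qed
  then show "S \<in> sets lebesgue" "emeasure lebesgue S = m" by auto
qed

lemma superlevel_radial_rearrangement:
  fixes f :: "real ^ 'n \<Rightarrow> ecomplex"
  assumes "f \<in> Meas" "0 \<le> s"
  shows "{x. ennreal s < radial_rearrangement f x} =
    {x. ennreal (unit_ball_vol (real CARD('n)) * norm x ^ CARD('n)) < distribution_function f s}"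
  using less_rearrangement_iff[OF assms] by (simp add: radial_rearrangement_def)

lemma measurable_radial_rearrangement:
  fixes f :: "real ^ 'n \<Rightarrow> ecomplex"
  assumes "f \<in> Meas"
  shows "radial_rearrangement f \<in> borel_measurable lebesgue"
proof (rule borel_measurableI_greater)
  fix y :: ennreal
  show "{x \<in> space lebesgue. y < radial_rearrangement f x} \<in> sets lebesgue"
    using superlevel_radial_rearrangement[OF assms] sublevel_volume(1) by (cases y) auto
qed

lemma distribution_function_radial_rearrangement:
  fixes f :: "real ^ 'n \<Rightarrow> ecomplex"
  assumes "f \<in> Meas" "0 \<le> s"
  shows "distribution_function (of_nonneg (radial_rearrangement f)) s = distribution_function f s"
  using superlevel_radial_rearrangement[OF assms]
  by (simp add: distribution_function_of_nonneg sublevel_volume(2))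

lemma rearrangement_invariant_eq_radial:
  fixes f :: "real ^ 'n \<Rightarrow> ecomplex"
  assumes "rearrangement_invariant N" "f \<in> Meas"
  shows "N (of_nonneg (radial_rearrangement f)) = N f"
proof -
  have "rearrangement (of_nonneg (radial_rearrangement f)) t = rearrangement f t" for t
    using assms(2)
    by (intro antisym rearrangement_mono) (simp_all add: distribution_function_radial_rearrangement)
  then show ?thesis
    using assms of_nonneg_in_Meas[OF measurable_radial_rearrangement]
    unfolding rearrangement_invariant_def by blast
qed

section \<open>Monotonicity of the norm in the distribution function\<close>

lemma quasi_Banach_function_norm_mono:
  fixes u v :: "real ^ 'n \<Rightarrow> ennreal"
  assumes "quasi_Banach_function_norm N"
    and "u \<in> borel_measurable lebesgue" "v \<in> borel_measurable lebesgue"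
    and "AE x in lebesgue. u x \<le> v x"
  shows "N (of_nonneg u) \<le> N (of_nonneg v)"
  using assms unfolding quasi_Banach_function_norm_def by blast

text \<open>The functions themselves need not be comparable pointwise, but their radial
  rearrangements are, and these have the same norms.\<close>

lemma norm_mono_distribution_function:
  fixes f g :: "real ^ 'n \<Rightarrow> ecomplex"
  assumes N: "quasi_Banach_function_norm N" "rearrangement_invariant N"
    and fg: "f \<in> Meas" "g \<in> Meas"
    and le: "\<And>s. 0 \<le> s \<Longrightarrow> distribution_function f s \<le> distribution_function g s"
  shows "N f \<le> N g"
proof -
  have "N (of_nonneg (radial_rearrangement f)) \<le> N (of_nonneg (radial_rearrangement g))"
    using fg rearrangement_mono[OF le]
    by (intro quasi_Banach_function_norm_mono[OF N(1)] measurable_radial_rearrangement)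
       (simp_all add: radial_rearrangement_def)
  then show ?thesis
    by (simp add: rearrangement_invariant_eq_radial[OF N(2)] fg)
qed

text \<open>The factor a^(-n) in the distribution function decreases in \<open>a\<close>. With
  \<open>c = 1\<close> this is the bound for \<open>a \<ge> 1\<close>.\<close>

lemma norm_dilation_antimono:
  fixes f :: "real ^ 'n \<Rightarrow> ecomplex"
  assumes N: "quasi_Banach_function_norm N" "rearrangement_invariant N"
    and f: "f \<in> Meas" and ca: "0 < c" "c \<le> a"
  shows "N (dilation a f) \<le> N (dilation c f)"
proof (rule norm_mono_distribution_function[OF N])
  have "1 / a ^ CARD('n) \<le> 1 / c ^ CARD('n)"
    using ca by (intro divide_left_mono power_mono) auto
  then show "distribution_function (dilation a f) s \<le> distribution_function (dilation c f) s" for s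
    using ca by (auto simp: distribution_function_dilation intro!: mult_right_mono ennreal_leI)
qed (use f in \<open>auto intro: dilation_in_Meas\<close>)

section \<open>Cutting by a hyperplane: the bound for a single dilation\<close>

text \<open>The reflection in the origin preserves measure and \<open>S\<close> and exchanges the
  two disjoint open half-spaces. The hyperplane between them is dropped, hence an
  inequality.\<close>

lemma emeasure_halfspace_Int_symmetric:
  fixes S :: "(real ^ 'n) set"
  assumes S: "S \<in> sets lebesgue" "\<And>x. x \<in> S \<Longrightarrow> - x \<in> S"
  shows "2 * emeasure lebesgue (S \<inter> {x. 0 < v \<bullet> x}) \<le> emeasure lebesgue S"
proof -
  let ?P = "S \<inter> {x. 0 < v \<bullet> x}" and ?Q = "S \<inter> {x. v \<bullet> x < 0}"
  have "?Q = (*\<^sub>R) (-1) ` ?P"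
  proof (intro set_eqI iffI)
    fix x assume "x \<in> ?Q"
    then show "x \<in> (*\<^sub>R) (-1) ` ?P"
      using S(2) by (intro image_eqI[of _ _ "- x"]) auto
  qed (use S(2) in auto)
  then have eq: "emeasure lebesgue ?Q = emeasure lebesgue ?P"
    by (simp only: emeasure_lebesgue_scaleR) simp
  have PQ: "?P \<in> sets lebesgue" "?Q \<in> sets lebesgue"
    using S(1) open_halfspace_gt[of 0 v] open_halfspace_lt[of v 0]
    by (auto intro!: sets.Int simp: lebesgue_openin)
  have "?P \<inter> ?Q = {}" by auto
  then have "2 * emeasure lebesgue ?P = emeasure lebesgue (?P \<union> ?Q)"
    using plus_emeasure[OF PQ] eq by (simp add: mult_2)
  also have "\<dots> \<le> emeasure lebesgue S"
    using S(1) by (intro emeasure_mono) auto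
  finally show ?thesis .
qed

text \<open>The dilation at most doubles the distribution function, and restricting the radial
  rearrangement to a half-space halves it again. Each half thus has norm at most \<open>N f\<close>,
  and the quasi-triangle inequality joins the two.\<close>

lemma norm_dilation_le_two_concavity:
  fixes f :: "real ^ 'n \<Rightarrow> ecomplex"
  assumes N: "quasi_Banach_function_norm N" "rearrangement_invariant N" "modulus_of_concavity N C"
    and f: "f \<in> Meas" and c: "0 < c" "1 / 2 \<le> c ^ CARD('n)"
  shows "N (dilation c f) \<le> ennreal (2 * C) * N f"
proof -
  define g where "g = dilation c f"
  have g: "g \<in> Meas" unfolding g_def using f by (rule dilation_in_Meas)
  define u where "u = radial_rearrangement g"
  note [measurable] = measurable_radial_rearrangement[OF g, folded u_def]
  have u_minus: "u (- x) = u x" for x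
    by (simp add: u_def radial_rearrangement_def)
  \<comment> \<open>The normal vector is a parameter, so that one estimate serves both halves,
    \<open>h v\<close> and \<open>h (- v)\<close>.\<close>
  define h where "h v x = u x * indicator {x. 0 < v \<bullet> x} x" for v x :: "real ^ 'n"
  have meas_ind: "indicator {x. 0 < v \<bullet> x} \<in> borel_measurable lebesgue" for v :: "real ^ 'n"
    using open_halfspace_gt[of 0 v] by (intro borel_measurable_indicator) (auto simp: lebesgue_openin)
  have meas [measurable]: "h v \<in> borel_measurable lebesgue" for v
    unfolding h_def using meas_ind[of v] by measurable
  have half: "N (of_nonneg (h v)) \<le> N f" for v
  proof (rule norm_mono_distribution_function[OF N(1,2) of_nonneg_in_Meas[OF meas] f])
    fix s :: real assume s: "0 \<le> s"
    let ?S = "{x. ennreal s < u x}"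
    have S: "?S \<in> sets lebesgue"
    proof -
      have "{x \<in> space lebesgue. ennreal s < u x} \<in> sets lebesgue" by measurable
      then show ?thesis by simp
    qed
    have "{x. ennreal s < h v x} = ?S \<inter> {x. 0 < v \<bullet> x}"
      by (auto simp: h_def indicator_def)
    then have "2 * distribution_function (of_nonneg (h v)) s \<le> emeasure lebesgue ?S"
      using emeasure_halfspace_Int_symmetric[OF S, of v] u_minus
      by (simp add: distribution_function_of_nonneg)
    also have "\<dots> = distribution_function g s"
      using distribution_function_radial_rearrangement[OF g s]
      by (simp add: distribution_function_of_nonneg u_def)
    also have "\<dots> = ennreal (1 / c ^ CARD('n)) * distribution_function f s"
      unfolding g_def by (rule distribution_function_dilation[OF c(1)])
    \<comment> \<open>The lower bound 1/2 on \<open>c ^ CARD('n)\<close> enters here; the resulting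
      2 cancels the one gained from the half-space.\<close>
    also have "\<dots> \<le> ennreal 2 * distribution_function f s"
      using c by (intro mult_right_mono ennreal_leI) (auto simp: field_simps)
    finally show "distribution_function (of_nonneg (h v)) s \<le> distribution_function f s"
      by (simp add: ennreal_mult_le_mult_iff)
  qed
  \<comment> \<open>The vector with all entries 1, a concrete choice of a nonzero normal.\<close>
  define v :: "real ^ 'n" where "v = 1"
  have "v \<noteq> 0" by (simp add: v_def)
  have "AE x in lebesgue. v \<bullet> x \<noteq> 0"
    using negligible_hyperplane[of v 0] \<open>v \<noteq> 0\<close>
    by (intro AE_I'[of "{x. v \<bullet> x = 0}"]) (auto simp: negligible_iff_null_sets)
  \<comment> \<open>Off the null hyperplane exactly one of the two indicators is 1.\<close>
  then have "AE x in lebesgue. u x \<le> h v x + h (- v) x"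
    by eventually_elim (auto simp: h_def indicator_def)
  then have "N (of_nonneg u) \<le> N (of_nonneg (\<lambda>x. h v x + h (- v) x))"
    by (intro quasi_Banach_function_norm_mono[OF N(1)]) measurable
  also have "\<dots> \<le> ennreal C * (N (of_nonneg (h v)) + N (of_nonneg (h (- v))))"
    using N(3) meas unfolding modulus_of_concavity_def by blast
  also have "\<dots> \<le> ennreal C * (N f + N f)"
    by (intro mult_left_mono add_mono half) auto
  also have "\<dots> = ennreal (2 * C) * N f"
    using N(3) by (simp add: ennreal_mult modulus_of_concavity_def mult_2[symmetric] ac_simps)
  finally show ?thesis
    using rearrangement_invariant_eq_radial[OF N(2) g] by (simp add: u_def g_def)
qed

section \<open>Iteration and the choice of the exponent\<close>

lemma norm_dilation_power:
  fixes f :: "real ^ 'n \<Rightarrow> ecomplex"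
  assumes N: "quasi_Banach_function_norm N" "rearrangement_invariant N" "modulus_of_concavity N C"
    and f: "f \<in> Meas" and c: "0 < c" "1 / 2 \<le> c ^ CARD('n)"
  shows "N (dilation (c ^ k) f) \<le> ennreal ((2 * C) ^ k) * N f"
proof (induction k)
  case 0
  then show ?case by (simp add: dilation_def)
next
  case (Suc k)
  have C: "0 \<le> C" using N(3) by (simp add: modulus_of_concavity_def)
  have "dilation (c ^ Suc k) f = dilation c (dilation (c ^ k) f)"
    by (simp add: dilation_def ac_simps)
  then have "N (dilation (c ^ Suc k) f) \<le> ennreal (2 * C) * N (dilation (c ^ k) f)"
    using norm_dilation_le_two_concavity[OF N dilation_in_Meas[OF f] c] by simp
  also have "\<dots> \<le> ennreal (2 * C) * (ennreal ((2 * C) ^ k) * N f)"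
    by (intro mult_left_mono Suc) auto
  also have "\<dots> = ennreal ((2 * C) ^ Suc k) * N f"
    using C by (simp add: ennreal_mult mult.assoc)
  finally show ?case .
qed

text \<open>Take \<open>k\<close> as the logarithm \<open>L\<close> of \<open>a\<close> to base
  \<open>b\<close>, rounded up. Rounding costs at most one extra factor \<open>c\<close>, and
  \<open>c powr L\<close> equals \<open>a powr (ln c / ln b)\<close>. With \<open>c = 2 * C\<close>
  this yields the constant of the theorem.\<close>

lemma exists_power_le_and_power_le_powr:
  fixes a b c :: real
  assumes a: "0 < a" "a < 1" and b: "0 < b" "b < 1" and c: "1 \<le> c"
  obtains k where "b ^ k \<le> a" "c ^ k \<le> c * a powr (ln c / ln b)"
proof -
  define L where "L = ln a / ln b"
  have L: "0 < L" using a b by (simp add: L_def divide_neg_neg)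
  define k where "k = nat \<lceil>L\<rceil>"
  have k: "L \<le> real k" "real k \<le> L + 1" using L unfolding k_def by linarith+
  have "b ^ k = b powr real k" using b by (simp add: powr_realpow)
  also have "\<dots> \<le> b powr L" using b k by (intro powr_mono') auto
  also have "\<dots> = a" using a b by (simp add: L_def powr_def)
  finally have 1: "b ^ k \<le> a" .
  have "c ^ k = c powr real k" using c by (simp add: powr_realpow)
  also have "\<dots> \<le> c powr (L + 1)" using c k by (intro powr_mono) auto
  also have "\<dots> = c * a powr (ln c / ln b)"
    using a c by (simp add: powr_add) (simp add: L_def powr_def)
  finally show thesis using 1 that by blast
qed

theorem theorem3p23:
  fixes N :: "(real ^ 'n \<Rightarrow> ecomplex) \<Rightarrow> ennreal" and C a b :: real
  assumes "quasi_Banach_function_norm N"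
    and "rearrangement_invariant N"
    and "modulus_of_concavity N C"
    and "b = (2/3) powr (1 / real CARD('n))"
    and "0 < a"
  shows "dilation_bounded N a \<and>
    dilation_norm N a \<le>
      ennreal (if a < 1 then 2 * C * a powr (ln (2 * C) / ln b) else 1)"
proof -
  let ?K = "if a < 1 then 2 * C * a powr (ln (2 * C) / ln b) else 1"
  have C: "1 \<le> C" using assms(3) by (simp add: modulus_of_concavity_def)
  have bn: "b ^ CARD('n) = 2 / 3"
    using assms(4) by (simp add: powr_realpow[symmetric] powr_powr)
  have b: "0 < b" using assms(4) by simp
  have b1: "b < 1" using one_le_power[of b "CARD('n)"] bn by (cases "1 \<le> b") auto
  \<comment> \<open>Proved for every measurable \<open>f\<close>, whether or not its norm is finite;
    the unit ball enters only in the supremum.\<close>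
  have bound: "N (dilation a f) \<le> ennreal ?K * N f" if f: "f \<in> Meas" for f
  proof (cases "a < 1")
    case True
    obtain k where k: "b ^ k \<le> a" "(2 * C) ^ k \<le> 2 * C * a powr (ln (2 * C) / ln b)"
      using exists_power_le_and_power_le_powr[of a b "2 * C"] assms(5) True b b1 C by auto
    have "N (dilation a f) \<le> N (dilation (b ^ k) f)"
      using b k(1) by (intro norm_dilation_antimono assms f) auto
    \<comment> \<open>The iteration applies because \<open>b ^ CARD('n)\<close> is 2/3, hence at
      least 1/2.\<close>
    also have "\<dots> \<le> ennreal ((2 * C) ^ k) * N f"
      using bn b by (intro norm_dilation_power assms f) auto
    also have "\<dots> \<le> ennreal ?K * N f"
      using k(2) True by (intro mult_right_mono ennreal_leI) auto
    finally show ?thesis .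
  next
    case False
    then show ?thesis
      using norm_dilation_antimono[OF assms(1,2) f, of 1 a] by (simp add: dilation_def)
  qed
  have "dilation_norm N a \<le> ennreal ?K"
    unfolding dilation_norm_def
  proof (rule SUP_least)
    fix f assume "f \<in> {f \<in> function_space N. N f \<le> 1}"
    then have "f \<in> Meas" "N f \<le> 1" by (auto simp: function_space_def)
    then show "N (dilation a f) \<le> ennreal ?K"
      using bound[of f] mult_left_mono[of "N f" 1 "ennreal ?K"] by (auto intro: order_trans)
  qed
  then show ?thesis
    unfolding dilation_bounded_def by (auto intro: le_less_trans)
qed

end
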